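(* Let $k\ge 3$ be an integer and let $\phi:(-1,1)\to\mathbb{R}$ be a $C^{k+1}$ function. Assume there is $x_0\in(-1,1)$ such that $$\phi'(x_0)=\phi''(x_0)=\ldots=\phi^{(k-1)}(x_0)=0,\qquad \phi^{(k)}(x_0)\neq 0.$$ Then there is a constant $c>0$ depending on $\phi$, but independent of $N$, such that for each integer $N\ge 1$ there exist $a_n\in\mathbb{C}$, $-N\le n\le N$, not all zero, such that for each $p\ge 2$ $$\Big\|\sum_{n=-N}^N a_n e(nx-n^2\phi(x))\Big\|_{L^p(-1,1)}\ge c\, N^{\frac{2k-1}{6(k-1)}-\frac{k+1}{3p(k-1)}}\Big(\sum_{n=-N}^N|a_n|^2\Big)^{1/2}.$$
   Context: $e(z)=e^{2\pi i z}$. The $L^p(-1,1)$ norm is taken in the real variable $x$. *)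

theory Defs
  imports "HOL-Analysis.Analysis"
begin

definition e :: "complex \<Rightarrow> complex" where
  "e z = exp (2 * complex_of_real pi * \<i> * z)"

(* f is m times continuously differentiable on S. Meant for open S: then each iterated
   derivative at a point of S depends only on the values of f on S, so a function on S is
   represented by an arbitrary total extension. Continuity of the derivatives of order
   below m follows from their differentiability. *)
definition C_k_on :: "nat \<Rightarrow> (real \<Rightarrow> real) \<Rightarrow> real set \<Rightarrow> bool" where
  "C_k_on m f S \<longleftrightarrow>
     (\<forall>j<m. \<forall>x\<in>S. (deriv ^^ j) f differentiable (at x)) \<and>
     continuous_on S ((deriv ^^ m) f)"

(* The Lebesgue L^p norm on S, for finite p. *)
definition Lp_norm :: "real \<Rightarrow> real set \<Rightarrow> (real \<Rightarrow> complex) \<Rightarrow> real" where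
  "Lp_norm p S f = (LINT x:S|lborel. norm (f x) powr p) powr (1 / p)"

end

(* Put g = s * phi with s = 1 or -1 chosen so that g' > 0 to the right of x0, and h = N div 2.
   Since g' vanishes to order k - 1 at x0, there is x1 = x0 + O(h^(-1/(k-1))) with
   2 h g'(x1) = 1. Compare the phase at n = s (h + m) with the one at n = s h: between x1 and x
   the difference changes by a part linear in m, which has no first-order term in x - x1 and is
   O(m h g'' (x - x1)^2) with g'' = O(h^(-(k-2)/(k-1))), and a part quadratic in m, which is
   O(m^2 |x - x1| / h). Both are small for |x - x1| <= h^(-beta) and 0 <= m <= eps h^mu, where
   beta = (k+1)/(3(k-1)) and mu = (2k-1)/(3(k-1)) balance the two. Coefficients of modulus 1 on
   this block that align the phases at x1 give a sum comparable to the block length on an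
   interval of length h^(-beta). For bounded N the single coefficient a_0 = 1 is enough. *)
theory Submission
  imports Defs
begin

section \<open>Derivatives to the right of the flat point\<close>

lemma C_k_on_DERIV:
  assumes "C_k_on m f S" "j < m" "x \<in> S"
  shows "((deriv ^^ j) f has_real_derivative (deriv ^^ Suc j) f x) (at x)"
  using assms by (simp add: C_k_on_def DERIV_deriv_iff_real_differentiable)

text \<open>Taylor's formula of order k - i at x0, applied to the i-th derivative, has only its
  remainder left, because the derivatives of orders i to k - 1 vanish there. In the remainder,
  \<open>(deriv ^^ k) f\<close> stays close to its nonzero value at x0 by continuity. The factor
  \<open>sgn\<close> makes all these quantities positive. The case i = 0 is excluded since f x0
  itself is arbitrary.\<close>

lemma flat_point_derivative_bounds:
  fixes f :: "real \<Rightarrow> real"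
  assumes C: "C_k_on (k + 1) f {a<..<b}" and x0: "x0 \<in> {a<..<b}"
    and flat: "\<And>j. 1 \<le> j \<Longrightarrow> j \<le> k - 1 \<Longrightarrow> (deriv ^^ j) f x0 = 0"
    and nz: "(deriv ^^ k) f x0 \<noteq> 0"
  obtains r where "r > 0" "x0 + r < b"
    "\<And>i y. \<lbrakk>1 \<le> i; i < k; 0 < y; y \<le> r\<rbrakk> \<Longrightarrow>
      \<bar>(deriv ^^ k) f x0\<bar> / 2 / fact (k - i) * y ^ (k - i)
        \<le> sgn ((deriv ^^ k) f x0) * (deriv ^^ i) f (x0 + y)"
    "\<And>i y. \<lbrakk>1 \<le> i; i < k; 0 < y; y \<le> r\<rbrakk> \<Longrightarrow>
      sgn ((deriv ^^ k) f x0) * (deriv ^^ i) f (x0 + y)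
        \<le> 2 * \<bar>(deriv ^^ k) f x0\<bar> * y ^ (k - i)"
proof -
  define A where "A = (deriv ^^ k) f x0"
  have "isCont ((deriv ^^ k) f) x0"
    using C_k_on_DERIV[OF C _ x0, of k] by (intro DERIV_isCont) auto
  moreover have "\<bar>A\<bar> / 2 > 0" using nz by (simp add: A_def)
  ultimately obtain d where d: "d > 0"
    "\<And>x. \<bar>x - x0\<bar> < d \<Longrightarrow> \<bar>(deriv ^^ k) f x - A\<bar> < \<bar>A\<bar> / 2"
    unfolding continuous_at_eps_delta A_def dist_real_def by metis
  \<comment> \<open>Half the distance to b keeps the closed interval from x0 to x0 + r inside the
    open domain.\<close>
  define r where "r = min d ((b - x0) / 2)"
  have r: "r > 0" "r \<le> d" "x0 + r < b"
    using d x0 by (auto simp: r_def min_def field_simps)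
  have top: "\<bar>A\<bar> / 2 \<le> sgn A * (deriv ^^ k) f t" "sgn A * (deriv ^^ k) f t \<le> 2 * \<bar>A\<bar>"
    if "x0 < t" "t < x0 + r" for t
  proof -
    have "\<bar>(deriv ^^ k) f t - A\<bar> < \<bar>A\<bar> / 2" using that r by (intro d) auto
    then show "\<bar>A\<bar> / 2 \<le> sgn A * (deriv ^^ k) f t" "sgn A * (deriv ^^ k) f t \<le> 2 * \<bar>A\<bar>"
      by (auto simp: sgn_if abs_if split: if_splits)
  qed
  have taylor: "\<exists>t. x0 < t \<and> t < x0 + y \<and>
      (deriv ^^ i) f (x0 + y) = (deriv ^^ k) f t / fact (k - i) * y ^ (k - i)"
    if i: "1 \<le> i" "i < k" and y: "0 < y" "y \<le> r" for i y
  proof -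
    have "\<exists>t>x0. t < x0 + y \<and> (deriv ^^ i) f (x0 + y) =
        (\<Sum>m<k-i. (deriv ^^ (i + m)) f x0 / fact m * (x0 + y - x0) ^ m)
        + (deriv ^^ (i + (k - i))) f t / fact (k - i) * (x0 + y - x0) ^ (k - i)"
    proof (rule Taylor_up)
      show "\<forall>m t. m < k - i \<and> x0 \<le> t \<and> t \<le> x0 + y \<longrightarrow>
          ((deriv ^^ (i + m)) f has_real_derivative (deriv ^^ (i + Suc m)) f t) (at t)"
      proof (intro allI impI, elim conjE)
        fix m t assume "m < k - i" "x0 \<le> t" "t \<le> x0 + y"
        then show "((deriv ^^ (i + m)) f has_real_derivative (deriv ^^ (i + Suc m)) f t) (at t)"
          using C_k_on_DERIV[OF C, of "i + m" t] x0 r y by auto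
      qed
    qed (use that in auto)
    moreover have "(\<Sum>m<k-i. (deriv ^^ (i + m)) f x0 / fact m * (x0 + y - x0) ^ m) = 0"
      using i by (intro sum.neutral) (auto simp: flat)
    ultimately show ?thesis using i by auto
  qed
  show ?thesis
  proof (rule that[OF r(1,3)])
    fix i y assume *: "1 \<le> i" "i < k" "0 < y" "y \<le> r"
    obtain t where t: "x0 < t" "t < x0 + y"
      "(deriv ^^ i) f (x0 + y) = (deriv ^^ k) f t / fact (k - i) * y ^ (k - i)"
      using taylor[OF *] by blast
    have "t < x0 + r" using t * by simp
    note b = top[OF t(1) this]
    have eq: "sgn A * (deriv ^^ i) f (x0 + y)
        = (sgn A * (deriv ^^ k) f t) / fact (k - i) * y ^ (k - i)" by (simp add: t)
    show "\<bar>(deriv ^^ k) f x0\<bar> / 2 / fact (k - i) * y ^ (k - i)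
        \<le> sgn ((deriv ^^ k) f x0) * (deriv ^^ i) f (x0 + y)"
      unfolding A_def[symmetric] eq
      using b(1) * by (intro mult_right_mono divide_right_mono) simp_all
    \<comment> \<open>The upper bound drops the factorial, which is at least 1.\<close>
    have "(sgn A * (deriv ^^ k) f t) / fact (k - i) \<le> 2 * \<bar>A\<bar> / fact (k - i)"
      using b by (intro divide_right_mono) auto
    also have "\<dots> \<le> 2 * \<bar>A\<bar> / 1" by (intro divide_left_mono) auto
    finally show "sgn ((deriv ^^ k) f x0) * (deriv ^^ i) f (x0 + y)
        \<le> 2 * \<bar>(deriv ^^ k) f x0\<bar> * y ^ (k - i)"
      unfolding A_def[symmetric] eq
      using * by (intro mult_right_mono) auto
  qed
qed

section \<open>The stationary point and the phase estimate around it\<close>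

text \<open>The quantity bounded by 1/6 is the phase n x - n^2 g(x) at n = h + m minus that at n =
  h, normalised to vanish at x1. Choosing x1 with 2 h g'(x1) = 1 cancels its term linear in both m
  and x - x1; the second-order Taylor remainder and the m^2 term are what is left. The value 1/6
  corresponds to an angle of pi/3, whose cosine is 1/2.\<close>

lemma almost_stationary_phase:
  fixes g g' g'' :: "real \<Rightarrow> real"
  assumes k: "k \<ge> 3" and r: "r > 0" and c: "c1 > 0" "c2 > 0"
    and g1: "\<And>x. \<lbrakk>x0 \<le> x; x \<le> x0 + r\<rbrakk> \<Longrightarrow> (g has_real_derivative g' x) (at x)"
    and g2: "\<And>x. \<lbrakk>x0 \<le> x; x \<le> x0 + r\<rbrakk> \<Longrightarrow> (g' has_real_derivative g'' x) (at x)"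
    and g'0: "g' x0 = 0"
    and lo: "\<And>y. \<lbrakk>0 < y; y \<le> r\<rbrakk> \<Longrightarrow> c1 * y ^ (k - 1) \<le> g' (x0 + y)"
    and up: "\<And>y. \<lbrakk>0 < y; y \<le> r\<rbrakk> \<Longrightarrow> \<bar>g'' (x0 + y)\<bar> \<le> c2 * y ^ (k - 2)"
  obtains \<epsilon> where "\<epsilon> > 0" "\<epsilon> \<le> 1"
    "\<forall>\<^sub>F h in at_top. \<exists>x1. x0 \<le> x1 \<and> x1 + h powr - ((real k + 1) / (3 * (real k - 1))) \<le> x0 + r \<and>
      (\<forall>x m. x1 \<le> x \<longrightarrow> x \<le> x1 + h powr - ((real k + 1) / (3 * (real k - 1))) \<longrightarrow>
        0 \<le> m \<longrightarrow> m \<le> \<epsilon> * h powr ((2 * real k - 1) / (3 * (real k - 1))) \<longrightarrow>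
        \<bar>m * (x - x1) - (2 * h * m + m\<^sup>2) * (g x - g x1)\<bar> \<le> 1 / 6)"
proof -
  define \<beta> where "\<beta> = (real k + 1) / (3 * (real k - 1))"
  define \<mu> where "\<mu> = (2 * real k - 1) / (3 * (real k - 1))"
  \<comment> \<open>\<open>C1\<close> makes g' reach 1/(2h) within distance C1 T of x0, where
    T^(k-1) = 1/h. \<open>C2\<close> T^(k-2) bounds |g''| up to distance 2 C1 T. The three error
    terms will be at most \<epsilon> C2, \<epsilon> and \<epsilon> C2, so \<epsilon> is chosen to
    make their sum 1/6.\<close>
  define C1 where "C1 = max 1 (1 / (2 * c1))"
  define C2 where "C2 = c2 * (2 * C1) ^ (k - 2)"
  define \<epsilon> where "\<epsilon> = 1 / (6 * (1 + 2 * C2))"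
  have C1: "C1 \<ge> 1" "1 \<le> C1 * 2 * c1"
    using c by (auto simp: C1_def max_def field_simps)
  have C2: "C2 > 0" using C1 c by (auto simp: C2_def)
  have eps: "\<epsilon> > 0" "\<epsilon> \<le> 1" "\<epsilon> * (1 + 2 * C2) = 1 / 6"
    using C2 by (auto simp: \<epsilon>_def field_simps)
  have "((\<lambda>h::real. h powr - (1 / (real k - 1))) \<longlongrightarrow> 0) at_top"
    using k by (intro tendsto_neg_powr filterlim_ident) auto
  then have "\<forall>\<^sub>F h::real in at_top. h powr - (1 / (real k - 1)) < r / (2 * C1)"
    using r C1 by (intro order_tendstoD(2)) auto
  moreover have "\<forall>\<^sub>F h::real in at_top. h \<ge> 1" by (rule eventually_ge_at_top)
  ultimately have "\<forall>\<^sub>F h in at_top. \<exists>x1. x0 \<le> x1 \<and> x1 + h powr - \<beta> \<le> x0 + r \<and>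
      (\<forall>x m. x1 \<le> x \<longrightarrow> x \<le> x1 + h powr - \<beta> \<longrightarrow> 0 \<le> m \<longrightarrow> m \<le> \<epsilon> * h powr \<mu> \<longrightarrow>
        \<bar>m * (x - x1) - (2 * h * m + m\<^sup>2) * (g x - g x1)\<bar> \<le> 1 / 6)"
  proof eventually_elim
    case (elim h)
    \<comment> \<open>\<open>T\<close> is the scale of x1 - x0, and \<delta> is the length of the
      interval on which the phases stay aligned.\<close>
    define T where "T = h powr - (1 / (real k - 1))"
    define \<delta> where "\<delta> = h powr - \<beta>"
    have T: "T > 0" using elim by (simp add: T_def)
    have \<delta>: "\<delta> > 0" using elim by (simp add: \<delta>_def)
    have Tr: "2 * C1 * T \<le> r" using elim C1 by (simp add: T_def field_simps)
    have Tk: "T ^ (k - 1) = 1 / h"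
    proof -
      have "T ^ (k - 1) = T powr real (k - 1)" using T by (simp add: powr_realpow)
      also have "\<dots> = h powr - 1" using k by (simp add: T_def powr_powr of_nat_diff)
      finally show ?thesis using elim by (simp add: powr_minus_divide)
    qed
    have hT: "h * T ^ (k - 2) * T = 1"
    proof -
      have "Suc (k - 2) = k - 1" using k by simp
      then have "T ^ (k - 2) * T = T ^ (k - 1)" by (metis power_Suc2)
      then show ?thesis using Tk elim by (simp add: mult.assoc)
    qed
    \<comment> \<open>Since k + 1 is at least 3, the aligned interval is no longer than T, so g''
      keeps its order of magnitude T^(k-2) along it.\<close>
    have \<delta>T: "\<delta> \<le> T" unfolding \<delta>_def T_def \<beta>_def
    proof (rule powr_mono)
      have "3 * 1 \<le> real k + 1" using k by simp
      then have "3 * 1 / (3 * (real k - 1)) \<le> (real k + 1) / (3 * (real k - 1))"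
        using k by (intro divide_right_mono) auto
      then show "- ((real k + 1) / (3 * (real k - 1))) \<le> - (1 / (real k - 1))"
        by (simp only: mult_divide_mult_cancel_left neg_le_iff_le)
    qed (use elim in auto)
    \<comment> \<open>The balance equations \<mu> - 2\<beta> = -1/(k-1) and, in \<open>e2\<close>,
      2\<mu> - \<beta> = 1 determine both exponents: the first controls m h g'' u^2, the second m^2
      u / h.\<close>
    have e1: "h powr \<mu> * \<delta>\<^sup>2 = T"
    proof -
      have "h powr \<mu> * \<delta>\<^sup>2 = h powr (\<mu> + (- \<beta> + - \<beta>))"
        by (simp only: \<delta>_def power2_eq_square powr_add)
      also have "\<mu> + (- \<beta> + - \<beta>) = - (1 / (real k - 1))"
        using k by (simp add: \<mu>_def \<beta>_def divide_simps)
      finally show ?thesis by (simp add: T_def)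
    qed
    have e2: "(h powr \<mu>)\<^sup>2 * \<delta> = h"
    proof -
      have "(h powr \<mu>)\<^sup>2 * \<delta> = h powr (\<mu> + \<mu> + - \<beta>)"
        by (simp only: \<delta>_def power2_eq_square powr_add)
      also have "\<mu> + \<mu> + - \<beta> = 1"
        using k by (simp add: \<mu>_def \<beta>_def divide_simps)
      finally show ?thesis using elim by simp
    qed
    have e3: "h powr \<mu> \<le> h"
    proof -
      have "h powr \<mu> \<le> h powr 1" using elim k
        by (intro powr_mono) (auto simp: \<mu>_def field_simps)
      then show ?thesis using elim by simp
    qed
    have C1T: "1 / (2 * h) \<le> c1 * (C1 * T) ^ (k - 1)"
    proof -
      have "C1 ^ 1 \<le> C1 ^ (k - 1)" using C1 k by (intro power_increasing) auto
      then have "c1 * C1 ^ 1 \<le> c1 * C1 ^ (k - 1)" using c by simp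
      then have "1 \<le> 2 * (c1 * C1 ^ (k - 1))" using C1(2) by (simp add: mult_ac)
      then show ?thesis unfolding power_mult_distrib Tk using elim by (simp add: field_simps)
    qed
    have pos: "0 < C1 * T" using C1 T by simp
    \<comment> \<open>g' climbs from 0 at x0 to at least 1/(2h), so the intermediate value theorem
      supplies x1.\<close>
    have "\<exists>x\<ge>x0. x \<le> x0 + C1 * T \<and> g' x = 1 / (2 * h)"
    proof (rule IVT)
      show "g' x0 \<le> 1 / (2 * h)" using g'0 elim by simp
      show "1 / (2 * h) \<le> g' (x0 + C1 * T)"
        using C1T lo[of "C1 * T"] pos Tr by simp
      show "x0 \<le> x0 + C1 * T" using pos by simp
      show "\<forall>x. x0 \<le> x \<and> x \<le> x0 + C1 * T \<longrightarrow> isCont g' x"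
        using pos Tr by (auto intro!: DERIV_isCont[OF g2])
    qed
    then obtain x1 where x1: "x0 \<le> x1" "x1 \<le> x0 + C1 * T" "g' x1 = 1 / (2 * h)" by blast
    have "1 * T \<le> C1 * T" using C1 T by (intro mult_right_mono) auto
    then have end_le: "x1 + \<delta> \<le> x0 + 2 * C1 * T" using x1 \<delta>T by simp
    show ?case
    proof (intro exI[of _ x1] conjI allI impI)
      show "x0 \<le> x1" by fact
      show "x1 + h powr - \<beta> \<le> x0 + r" using end_le Tr by (simp add: \<delta>_def)
      fix x m :: real
      assume x: "x1 \<le> x" "x \<le> x1 + h powr - \<beta>" and m: "0 \<le> m" "m \<le> \<epsilon> * h powr \<mu>"
      define u where "u = x - x1"
      have u: "0 \<le> u" "u \<le> \<delta>" using x by (auto simp: u_def \<delta>_def)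
      show "\<bar>m * (x - x1) - (2 * h * m + m\<^sup>2) * (g x - g x1)\<bar> \<le> 1 / 6"
      proof (cases "x = x1")
        case False
        \<comment> \<open>Packs g, g', g'' into the sequence of derivatives that
          \<open>Taylor_up\<close> expects.\<close>
        define D where "D j = (if j = 0 then g else if j = 1 then g' else g'')" for j :: nat
        have "\<exists>t>x1. t < x \<and> g x = (\<Sum>j<2. D j x1 / fact j * (x - x1) ^ j)
            + D 2 t / fact 2 * (x - x1) ^ 2"
        proof (rule Taylor_up)
          show "\<forall>j t. j < 2 \<and> x1 \<le> t \<and> t \<le> x \<longrightarrow> (D j has_real_derivative D (Suc j) t) (at t)"
          proof (intro allI impI, elim conjE)
            fix j :: nat and t assume j: "j < 2" "x1 \<le> t" "t \<le> x"
            then have "x0 \<le> t" "t \<le> x0 + r" using x1 x end_le Tr by (auto simp: \<delta>_def)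
            then show "(D j has_real_derivative D (Suc j) t) (at t)"
              using j(1) g1[of t] g2[of t] by (cases "j = 0") (auto simp: D_def)
          qed
        qed (use x False in \<open>auto simp: D_def\<close>)
        then obtain t where t: "x1 < t" "t < x"
          "g x = (\<Sum>j<2. D j x1 / fact j * (x - x1) ^ j) + D 2 t / fact 2 * (x - x1) ^ 2"
          by blast
        \<comment> \<open>2 h (g x - g x1) splits into u, which comes from 2 h g'(x1) = 1, and the
          second-order remainder w.\<close>
        define w where "w = h * g'' t * u\<^sup>2"
        have gx: "g x - g x1 = (u + w) / (2 * h)"
          using t(3) elim x1 by (simp add: D_def u_def w_def eval_nat_numeral field_simps)
        have "\<bar>g'' (x0 + (t - x0))\<bar> \<le> c2 * (t - x0) ^ (k - 2)"
          using t x x1 end_le Tr by (intro up) (auto simp: \<delta>_def)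
        also have "\<dots> \<le> c2 * (2 * C1 * T) ^ (k - 2)"
          using t x x1 end_le c by (intro mult_left_mono power_mono) (auto simp: \<delta>_def)
        finally have g''t: "\<bar>g'' t\<bar> \<le> C2 * T ^ (k - 2)"
          by (simp add: C2_def power_mult_distrib)
        have mw: "m * \<bar>w\<bar> \<le> \<epsilon> * C2"
        proof -
          have "m * \<bar>w\<bar> = m * (h * (\<bar>g'' t\<bar> * u\<^sup>2))" using elim by (simp add: w_def abs_mult)
          also have "\<dots> \<le> (\<epsilon> * h powr \<mu>) * (h * ((C2 * T ^ (k - 2)) * \<delta>\<^sup>2))"
            using m u g''t elim C2 T \<delta> eps by (intro mult_mono power_mono) auto
          also have "\<dots> = \<epsilon> * C2 * (h * T ^ (k - 2) * (h powr \<mu> * \<delta>\<^sup>2))" by (simp add: ac_simps)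
          also have "\<dots> = \<epsilon> * C2" by (simp only: e1 hT)
          finally show ?thesis .
        qed
        have mh: "m \<le> h"
        proof -
          have "\<epsilon> * h powr \<mu> \<le> 1 * h" using e3 eps elim by (intro mult_mono) auto
          then show ?thesis using m by simp
        qed
        have mu: "m\<^sup>2 * u \<le> \<epsilon> * (2 * h)"
        proof -
          have "m\<^sup>2 * u \<le> (\<epsilon> * h powr \<mu>)\<^sup>2 * \<delta>"
            using m u by (intro mult_mono power_mono) auto
          also have "\<dots> = \<epsilon> * \<epsilon> * h" using e2 by (simp add: power_mult_distrib power2_eq_square)
          also have "\<dots> \<le> \<epsilon> * 1 * (2 * h)" using eps elim by (intro mult_mono) auto
          finally show ?thesis by simp
        qed
        \<comment> \<open>The terms m u cancel. The last of the three remaining terms is dominated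
          by the first, because m is at most h.\<close>
        have "m * u - (2 * h * m + m\<^sup>2) * (g x - g x1)
            = - (m * w) - m\<^sup>2 * u / (2 * h) - m * (m * w) / (2 * h)"
          unfolding gx using elim by (simp add: field_simps power2_eq_square)
        then have "\<bar>m * u - (2 * h * m + m\<^sup>2) * (g x - g x1)\<bar>
            \<le> \<bar>m * w\<bar> + \<bar>m\<^sup>2 * u / (2 * h)\<bar> + \<bar>m * (m * w) / (2 * h)\<bar>" by linarith
        also have "\<bar>m\<^sup>2 * u / (2 * h)\<bar> \<le> \<epsilon>"
          using mu u elim eps by (simp add: abs_mult field_simps)
        also have "\<bar>m * (m * w) / (2 * h)\<bar> \<le> \<epsilon> * C2"
        proof -
          have "\<bar>m * (m * w) / (2 * h)\<bar> = m / (2 * h) * (m * \<bar>w\<bar>)"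
            using m elim by (simp add: abs_mult)
          also have "\<dots> \<le> 1 * (\<epsilon> * C2)"
            using m mh elim by (intro mult_mono[OF _ mw]) (auto simp: field_simps)
          finally show ?thesis by simp
        qed
        also have "\<bar>m * w\<bar> \<le> \<epsilon> * C2" using mw m by (simp add: abs_mult)
        also have "\<epsilon> * C2 + \<epsilon> + \<epsilon> * C2 = 1 / 6" using eps(3) by (simp add: algebra_simps)
        finally show ?thesis by (simp add: u_def)
      qed simp
    qed
  qed
  then show ?thesis using that eps unfolding \<beta>_def \<mu>_def by blast
qed

section \<open>Lower bounds for L^p norms and for aligned exponential sums\<close>

text \<open>The integral over the large interval dominates the one over the closed subinterval.
  Continuity and the bound B give integrability; a non-integrable function would have integral 0 by
  convention, and monotonicity would fail.\<close>

lemma Lp_norm_lower_bound: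
  fixes f :: "real \<Rightarrow> complex"
  assumes p: "p > 0" and cont: "continuous_on {a<..<b} f"
    and bnd: "\<And>x. x \<in> {a<..<b} \<Longrightarrow> norm (f x) \<le> B"
    and sub: "{u..v} \<subseteq> {a<..<b}" and uv: "u \<le> v" and L: "0 \<le> L"
    and lower: "\<And>x. x \<in> {u..v} \<Longrightarrow> L \<le> norm (f x)"
  shows "(v - u) powr (1 / p) * L \<le> Lp_norm p {a<..<b} f"
proof -
  have "continuous_on {a<..<b} (\<lambda>x. norm (f x) powr p)"
    using cont p by (intro continuous_on_powr' continuous_intros) auto
  then have meas: "(\<lambda>x. indicat_real {a<..<b} x *\<^sub>R norm (f x) powr p) \<in> borel_measurable lborel"
    using borel_measurable_continuous_on_indicator[of "{a<..<b}" "\<lambda>x. norm (f x) powr p"]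
    by (simp del: real_scaleR_def)
  have int: "integrable lborel (\<lambda>x. indicat_real {a<..<b} x *\<^sub>R norm (f x) powr p)"
  proof (rule integrableI_bounded_set[where A = "{a<..<b}" and B = "B powr p"])
    show "(\<lambda>x. indicat_real {a<..<b} x *\<^sub>R norm (f x) powr p) \<in> borel_measurable lborel"
      by (rule meas)
    show "AE x\<in>{a<..<b} in lborel. norm (indicat_real {a<..<b} x *\<^sub>R norm (f x) powr p) \<le> B powr p"
      using p by (intro AE_I2) (auto simp: bnd intro!: powr_mono2)
  qed (use emeasure_lborel_box_finite[of a b] in auto)
  have "(v - u) * L powr p = (LINT x:{u..v}|lborel. L powr p)"
    using uv by (simp add: set_lebesgue_integral_def)
  also have "\<dots> \<le> (LINT x:{a<..<b}|lborel. norm (f x) powr p)"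
    unfolding set_lebesgue_integral_def
  proof (rule integral_mono)
    show "integrable lborel (\<lambda>x. indicat_real {a<..<b} x *\<^sub>R norm (f x) powr p)"
      by (rule int)
    fix x show "indicat_real {u..v} x *\<^sub>R L powr p \<le> indicat_real {a<..<b} x *\<^sub>R norm (f x) powr p"
      using sub p L by (auto simp: indicator_def intro!: powr_mono2 lower)
  qed (use uv in \<open>auto intro!: integrable_real_indicator\<close>)
  finally have "((v - u) * L powr p) powr (1 / p) \<le> Lp_norm p {a<..<b} f"
    unfolding Lp_norm_def using uv p by (intro powr_mono2) auto
  then show ?thesis using p L uv by (simp add: powr_mult powr_powr)
qed

text \<open>Rotating the sum by the common phase \<theta>0 preserves its modulus and turns each term
  by an angle of at most pi/3 away from 1, so each real part is at least 1/2.\<close>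

lemma norm_sum_e_ge:
  fixes \<theta> :: "'a \<Rightarrow> real"
  assumes "\<And>i. i \<in> I \<Longrightarrow> \<bar>\<theta> i - \<theta>0\<bar> \<le> 1 / 6"
  shows "real (card I) / 2 \<le> norm (\<Sum>i\<in>I. e (of_real (\<theta> i)))"
proof -
  have e_cis: "e (of_real t) = cis (2 * pi * t)" for t
    by (simp add: e_def cis_conv_exp mult_ac)
  have "cos (2 * pi * (\<theta> i - \<theta>0)) \<ge> 1 / 2" if "i \<in> I" for i
  proof -
    have "\<bar>2 * pi * (\<theta> i - \<theta>0)\<bar> \<le> pi / 3" using assms[OF that] by (simp add: abs_mult)
    then have "cos \<bar>2 * pi * (\<theta> i - \<theta>0)\<bar> \<ge> cos (pi / 3)"
      by (intro cos_monotone_0_pi_le) auto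
    then show ?thesis by (simp add: cos_60)
  qed
  then have "real (card I) / 2 \<le> (\<Sum>i\<in>I. cos (2 * pi * (\<theta> i - \<theta>0)))"
    using sum_bounded_below[of I "1/2::real"] by fastforce
  also have "\<dots> = Re (\<Sum>i\<in>I. cis (2 * pi * (\<theta> i - \<theta>0)))" by simp
  also have "\<dots> \<le> norm (\<Sum>i\<in>I. cis (2 * pi * (\<theta> i - \<theta>0)))" by (rule complex_Re_le_cmod)
  also have "(\<Sum>i\<in>I. cis (2 * pi * (\<theta> i - \<theta>0)))
      = (\<Sum>i\<in>I. e (of_real (\<theta> i))) * cis (- 2 * pi * \<theta>0)"
    by (simp add: sum_distrib_right e_cis cis_mult right_diff_distrib)
  finally show ?thesis by (simp add: norm_mult)
qed


lemma norm_e_of_real [simp]: "norm (e (of_real t)) = 1"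
  by (simp add: e_def)

lemma e_add: "e (z + w) = e z * e w"
  by (simp add: e_def exp_add ring_distribs)

text \<open>Continuity of the sum and the trivial bound by the sum of the |a n| are what
  \<open>Lp_norm_lower_bound\<close> asks for.\<close>

lemma exponential_sum_Lp_norm_lower_bound:
  fixes \<phi> :: "real \<Rightarrow> real" and a :: "int \<Rightarrow> complex" and J :: "int set"
  defines "F \<equiv> \<lambda>x. \<Sum>n\<in>J. a n * e (complex_of_real (real_of_int n * x - (real_of_int n)\<^sup>2 * \<phi> x))"
  assumes p: "p > 0" and cont: "continuous_on {l<..<r} \<phi>"
    and sub: "{u..v} \<subseteq> {l<..<r}" and uv: "u \<le> v" and L: "0 \<le> L"
    and lower: "\<And>x. x \<in> {u..v} \<Longrightarrow> L \<le> norm (F x)"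
  shows "(v - u) powr (1 / p) * L \<le> Lp_norm p {l<..<r} F"
proof (rule Lp_norm_lower_bound[OF p _ _ sub uv L lower])
  show "continuous_on {l<..<r} F"
    unfolding F_def e_def by (intro continuous_intros cont)
  show "norm (F x) \<le> (\<Sum>n\<in>J. norm (a n))" for x
    unfolding F_def by (rule order_trans[OF norm_sum])
      (simp add: norm_mult del: of_real_diff of_real_mult of_real_power)
qed

section \<open>Choice of the coefficients and the final estimate\<close>

theorem theorem2p1:
  fixes k :: nat and \<phi> :: "real \<Rightarrow> real" and x\<^sub>0 :: real
  assumes "k \<ge> 3"
    and "C_k_on (k + 1) \<phi> {-1<..<1}"
    and "x\<^sub>0 \<in> {-1<..<1}"
    and "\<And>j. 1 \<le> j \<Longrightarrow> j \<le> k - 1 \<Longrightarrow> (deriv ^^ j) \<phi> x\<^sub>0 = 0"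
    and "(deriv ^^ k) \<phi> x\<^sub>0 \<noteq> 0"
  shows "\<exists>c::real. c > 0 \<and>
    (\<forall>N::nat. N \<ge> 1 \<longrightarrow>
      (\<exists>a :: int \<Rightarrow> complex.
        (\<exists>n\<in>{- int N..int N}. a n \<noteq> 0) \<and>
        (\<forall>p::real. p \<ge> 2 \<longrightarrow>
          Lp_norm p {-1<..<1}
            (\<lambda>x. \<Sum>n = - int N..int N.
               a n * e (complex_of_real (real_of_int n * x - (real_of_int n)\<^sup>2 * \<phi> x)))
          \<ge> c * real N powr ((2 * real k - 1) / (6 * (real k - 1))
                              - (real k + 1) / (3 * p * (real k - 1)))
              * sqrt (\<Sum>n = - int N..int N. (norm (a n))\<^sup>2))))"
proof -
  define A where "A = (deriv ^^ k) \<phi> x\<^sub>0"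
  define s where "s = sgn A"
  define \<beta> where "\<beta> = (real k + 1) / (3 * (real k - 1))"
  define \<mu> where "\<mu> = (2 * real k - 1) / (3 * (real k - 1))"
  note k = \<open>k \<ge> 3\<close>
  note D = C_k_on_DERIV[OF assms(2)]
  have A: "A \<noteq> 0" using assms by (simp add: A_def)
  have s: "s = 1 \<or> s = -1" using A by (auto simp: s_def sgn_if)
  have cont: "continuous_on {-1<..<1} \<phi>"
  proof (intro continuous_at_imp_continuous_on ballI)
    fix x :: real assume "x \<in> {-1<..<1}"
    from D[OF _ this, of 0] show "isCont \<phi> x" by (auto intro: DERIV_isCont)
  qed
  have \<beta>\<mu>: "\<beta> > 0" "\<mu> > 0" "\<mu> \<le> 1"
    using k by (auto simp: \<beta>_def \<mu>_def field_simps)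
  \<comment> \<open>A sum of size about N^\<mu> on an interval of length about N^(-\<beta>), divided
    by an l^2 norm of about N^(\<mu>/2), yields this exponent.\<close>
  have exponent: "(2 * real k - 1) / (6 * (real k - 1)) - (real k + 1) / (3 * p * (real k - 1))
      = \<mu> / 2 - \<beta> / p" if "p \<ge> 2" for p :: real
    using that k by (simp add: \<beta>_def \<mu>_def field_simps)

  obtain r where r: "r > 0" "x\<^sub>0 + r < 1"
    and lo: "\<And>i y. \<lbrakk>1 \<le> i; i < k; 0 < y; y \<le> r\<rbrakk> \<Longrightarrow>
        \<bar>A\<bar> / 2 / fact (k - i) * y ^ (k - i) \<le> s * (deriv ^^ i) \<phi> (x\<^sub>0 + y)"
    and up: "\<And>i y. \<lbrakk>1 \<le> i; i < k; 0 < y; y \<le> r\<rbrakk> \<Longrightarrow>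
        s * (deriv ^^ i) \<phi> (x\<^sub>0 + y) \<le> 2 * \<bar>A\<bar> * y ^ (k - i)"
    using flat_point_derivative_bounds[OF assms(2-5), folded A_def, folded s_def] by blast

  obtain \<epsilon> where \<epsilon>: "\<epsilon> > 0" "\<epsilon> \<le> 1" and ev:
    "\<forall>\<^sub>F h in at_top. \<exists>x1. x\<^sub>0 \<le> x1 \<and> x1 + h powr - \<beta> \<le> x\<^sub>0 + r \<and>
      (\<forall>x m. x1 \<le> x \<longrightarrow> x \<le> x1 + h powr - \<beta> \<longrightarrow> 0 \<le> m \<longrightarrow> m \<le> \<epsilon> * h powr \<mu> \<longrightarrow>
        \<bar>m * (x - x1) - (2 * h * m + m\<^sup>2) * (s * \<phi> x - s * \<phi> x1)\<bar> \<le> 1 / 6)"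
  proof (rule almost_stationary_phase[where g = "\<lambda>x. s * \<phi> x" and g' = "\<lambda>x. s * (deriv ^^ 1) \<phi> x"
        and g'' = "\<lambda>x. s * (deriv ^^ 2) \<phi> x" and k = k and r = r and ?x0.0 = x\<^sub>0
        and ?c1.0 = "\<bar>A\<bar> / 2 / fact (k - 1)" and ?c2.0 = "2 * \<bar>A\<bar>", folded \<beta>_def \<mu>_def])
    fix x assume "x\<^sub>0 \<le> x" "x \<le> x\<^sub>0 + r"
    then have x: "x \<in> {-1<..<1}" using r assms(3) by auto
    show "((\<lambda>x. s * \<phi> x) has_real_derivative s * (deriv ^^ 1) \<phi> x) (at x)"
      using D[OF _ x, of 0] by (intro DERIV_cmult) simp
    show "((\<lambda>x. s * (deriv ^^ 1) \<phi> x) has_real_derivative s * (deriv ^^ 2) \<phi> x) (at x)"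
      using D[OF _ x, of 1] k by (intro DERIV_cmult) (simp add: numeral_2_eq_2)
  next
    show "s * (deriv ^^ 1) \<phi> x\<^sub>0 = 0" using assms(4)[of 1] k by simp
  next
    fix y assume y: "0 < y" "y \<le> r"
    show "\<bar>A\<bar> / 2 / fact (k - 1) * y ^ (k - 1) \<le> s * (deriv ^^ 1) \<phi> (x\<^sub>0 + y)"
      using y k by (intro lo) auto
    \<comment> \<open>The lower bound for i = 2 serves only to remove the absolute value; i = 2 is
      admissible because k is at least 3.\<close>
    have "0 \<le> \<bar>A\<bar> / 2 / fact (k - 2) * y ^ (k - 2)" using y by simp
    also have "\<dots> \<le> s * (deriv ^^ 2) \<phi> (x\<^sub>0 + y)" using y k by (intro lo) auto
    finally show "\<bar>s * (deriv ^^ 2) \<phi> (x\<^sub>0 + y)\<bar> \<le> 2 * \<bar>A\<bar> * y ^ (k - 2)"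
      using up[of 2 y] y k by simp
  qed (use k r A in auto)
  then obtain H where H: "\<And>h. h \<ge> H \<Longrightarrow> \<exists>x1. x\<^sub>0 \<le> x1 \<and> x1 + h powr - \<beta> \<le> x\<^sub>0 + r \<and>
      (\<forall>x m. x1 \<le> x \<longrightarrow> x \<le> x1 + h powr - \<beta> \<longrightarrow> 0 \<le> m \<longrightarrow> m \<le> \<epsilon> * h powr \<mu> \<longrightarrow>
        \<bar>m * (x - x1) - (2 * h * m + m\<^sup>2) * (s * \<phi> x - s * \<phi> x1)\<bar> \<le> 1 / 6)"
    unfolding eventually_at_top_linorder by blast

  \<comment> \<open>For N at least \<open>N0\<close>, N div 2 is at least both H and 1. In
    \<open>c\<close>, the 6 combines a 3 from comparing N with 3h and a 2 from the lower bound on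
    the aligned sum; 1 / N0 handles the N below \<open>N0\<close>.\<close>
  define N0 where "N0 = 2 * max H 1 + 2"
  define c where "c = min (sqrt \<epsilon> / 6) (1 / N0)"
  have N0: "N0 > 0" by (simp add: N0_def max_def)
  have c: "c > 0" "c \<le> sqrt \<epsilon> / 6" "c * N0 \<le> 1"
    using \<epsilon> N0 by (auto simp: c_def min_def field_simps)
  let ?S = "\<lambda>N a x. \<Sum>n = - int N..int N.
      a n * e (complex_of_real (real_of_int n * x - (real_of_int n)\<^sup>2 * \<phi> x))"
  have main: "\<exists>a :: int \<Rightarrow> complex. (\<exists>n\<in>{- int N..int N}. a n \<noteq> 0) \<and>
      (\<forall>p::real. p \<ge> 2 \<longrightarrow> Lp_norm p {-1<..<1} (?S N a)
        \<ge> c * real N powr (\<mu> / 2 - \<beta> / p) * sqrt (\<Sum>n = - int N..int N. (norm (a n))\<^sup>2))"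
    if N: "N \<ge> 1" for N :: nat
  proof (cases "real N < N0")
    case True
    define a where "a n = (if n = 0 then 1 else 0 :: complex)" for n :: int
    have S: "?S N a x = 1" for x
    proof -
      have "?S N a x = (\<Sum>n\<in>{0}. a n * e (complex_of_real (real_of_int n * x - (real_of_int n)\<^sup>2 * \<phi> x)))"
        by (rule sum.mono_neutral_right) (auto simp: a_def)
      then show ?thesis by (simp add: a_def e_def)
    qed
    have l2: "(\<Sum>n = - int N..int N. (norm (a n))\<^sup>2) = 1"
    proof -
      have "(\<Sum>n = - int N..int N. (norm (a n))\<^sup>2) = (\<Sum>n\<in>{0}. (norm (a n))\<^sup>2)"
        by (rule sum.mono_neutral_right) (auto simp: a_def)
      then show ?thesis by (simp add: a_def)
    qed
    show ?thesis
    proof (intro exI[of _ a] conjI allI impI)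
      show "\<exists>n\<in>{- int N..int N}. a n \<noteq> 0" by (intro bexI[of _ 0]) (auto simp: a_def)
      fix p :: real assume p: "p \<ge> 2"
      have "real N powr (\<mu> / 2 - \<beta> / p) \<le> real N powr 1"
      proof (rule powr_mono)
        have "\<beta> / p > 0" using \<beta>\<mu> p by simp
        then show "\<mu> / 2 - \<beta> / p \<le> 1" using \<beta>\<mu> by simp
      qed (use N in auto)
      then have "c * real N powr (\<mu> / 2 - \<beta> / p) \<le> c * N0"
        using c True by (intro mult_left_mono) auto
      \<comment> \<open>The sum is identically 1, and [-1/2, 1/2] is a subinterval of length
        1.\<close>
      also have "\<dots> \<le> (1 / 2 - (- 1 / 2)) powr (1 / p) * 1" using c by simp
      also have "\<dots> \<le> Lp_norm p {-1<..<1} (?S N a)"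
        using p cont by (intro exponential_sum_Lp_norm_lower_bound) (auto simp only: S, auto)
      finally show "c * real N powr (\<mu> / 2 - \<beta> / p) * sqrt (\<Sum>n = - int N..int N. (norm (a n))\<^sup>2)
          \<le> Lp_norm p {-1<..<1} (?S N a)" by (simp only: l2) simp
    qed
  next
    case False
    \<comment> \<open>Half of N leaves room for the whole block from h to h + M, since M will be at
      most h.\<close>
    define h where "h = N div 2"
    have NN: "2 * real h \<le> real N" "real N \<le> 2 * real h + 1" unfolding h_def by linarith+
    have h: "H \<le> real h" "real h \<ge> 1"
      using False NN unfolding N0_def by linarith+
    obtain x1 where x1: "x\<^sub>0 \<le> x1" "x1 + real h powr - \<beta> \<le> x\<^sub>0 + r"
      and phase: "\<And>x m. \<lbrakk>x1 \<le> x; x \<le> x1 + real h powr - \<beta>; 0 \<le> m; m \<le> \<epsilon> * real h powr \<mu>\<rbrakk> \<Longrightarrow>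
        \<bar>m * (x - x1) - (2 * real h * m + m\<^sup>2) * (s * \<phi> x - s * \<phi> x1)\<bar> \<le> 1 / 6"
      using H[OF h(1)] by blast
    define M where "M = nat \<lfloor>\<epsilon> * real h powr \<mu>\<rfloor>"
    \<comment> \<open>The integer version of s. For s = -1 the block is reflected to negative
      frequencies, where the phase for \<phi> is the negative of the phase for -\<phi> at h +
      m.\<close>
    define \<sigma> :: int where "\<sigma> = (if s = 1 then 1 else -1)"
    have \<sigma>: "real_of_int \<sigma> = s" "\<sigma> = 1 \<or> \<sigma> = -1" using s by (auto simp: \<sigma>_def)
    define J where "J = (\<lambda>m. \<sigma> * (int h + int m)) ` {..M}"
    have M: "real M \<le> \<epsilon> * real h powr \<mu>" "\<epsilon> * real h powr \<mu> \<le> real M + 1"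
      using \<epsilon> by (auto simp: M_def)
    have "\<epsilon> * real h powr \<mu> \<le> 1 * real h powr 1"
      using \<epsilon> h \<beta>\<mu> by (intro mult_mono powr_mono) auto
    then have Mh: "M \<le> h" using M h by simp
    have J: "finite J" "J \<subseteq> {- int N..int N}" "card J = M + 1"
    proof -
      have "inj_on (\<lambda>m. \<sigma> * (int h + int m)) {..M}" using \<sigma> by (auto simp: inj_on_def)
      then show "card J = M + 1" by (simp add: J_def card_image)
      show "J \<subseteq> {- int N..int N}" using \<sigma>(2) Mh NN by (auto simp: J_def)
    qed (simp add: J_def)
    \<comment> \<open>These unimodular coefficients cancel every phase at x1. They depend on N but
      not on p.\<close>
    define a where "a n = (if n \<in> J then e (complex_of_real
        (- (real_of_int n * x1 - (real_of_int n)\<^sup>2 * \<phi> x1))) else 0)" for n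
    have S: "?S N a x = (\<Sum>n\<in>J. e (complex_of_real
        (real_of_int n * (x - x1) - (real_of_int n)\<^sup>2 * (\<phi> x - \<phi> x1))))" for x
    proof -
      have "?S N a x = (\<Sum>n\<in>J. a n * e (complex_of_real (real_of_int n * x - (real_of_int n)\<^sup>2 * \<phi> x)))"
        using J by (intro sum.mono_neutral_right) (auto simp: a_def)
      also have "\<dots> = (\<Sum>n\<in>J. e (complex_of_real
          (real_of_int n * (x - x1) - (real_of_int n)\<^sup>2 * (\<phi> x - \<phi> x1))))"
        by (intro sum.cong refl) (simp add: a_def e_add[symmetric] algebra_simps)
      finally show ?thesis .
    qed
    have l2: "(\<Sum>n = - int N..int N. (norm (a n))\<^sup>2) = real M + 1"
    proof -
      have "(\<Sum>n = - int N..int N. (norm (a n))\<^sup>2) = (\<Sum>n\<in>J. (norm (a n))\<^sup>2)"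
        using J by (intro sum.mono_neutral_right) (auto simp: a_def)
      also have "\<dots> = (\<Sum>n\<in>J. 1)" by (intro sum.cong refl) (simp only: a_def norm_e_of_real if_True, simp)
      finally show ?thesis using J by simp
    qed
    have lower: "(real M + 1) / 2 \<le> norm (?S N a x)" if x: "x \<in> {x1..x1 + real h powr - \<beta>}" for x
    proof -
      have "real (card J) / 2 \<le> norm (?S N a x)"
        unfolding S
      proof (rule norm_sum_e_ge)
        fix n assume "n \<in> J"
        then obtain m where m: "m \<le> M" "n = \<sigma> * (int h + int m)" by (auto simp: J_def)
        have "\<bar>real m * (x - x1) - (2 * real h * real m + (real m)\<^sup>2) * (s * \<phi> x - s * \<phi> x1)\<bar> \<le> 1 / 6"
          using x m M by (intro phase) auto
        \<comment> \<open>The reference phase is that of m = 0; the overall factor s comes out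
          because s^2 = 1.\<close>
        moreover have "real_of_int n * (x - x1) - (real_of_int n)\<^sup>2 * (\<phi> x - \<phi> x1)
            - (s * real h * (x - x1) - (real h)\<^sup>2 * (\<phi> x - \<phi> x1))
            = s * (real m * (x - x1) - (2 * real h * real m + (real m)\<^sup>2) * (s * \<phi> x - s * \<phi> x1))"
          using s by (auto simp: m \<sigma>(1) power2_eq_square algebra_simps)
        ultimately show "\<bar>real_of_int n * (x - x1) - (real_of_int n)\<^sup>2 * (\<phi> x - \<phi> x1)
            - (s * real h * (x - x1) - (real h)\<^sup>2 * (\<phi> x - \<phi> x1))\<bar> \<le> 1 / 6"
          using s by (auto simp: abs_mult)
      qed
      then show ?thesis using J by (simp add: add.commute)
    qed
    show ?thesis
    proof (intro exI[of _ a] conjI allI impI)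
      show "\<exists>n\<in>{- int N..int N}. a n \<noteq> 0"
      proof (rule ccontr)
        assume "\<not> ?thesis"
        then have "(\<Sum>n = - int N..int N. (norm (a n))\<^sup>2) = 0" by (intro sum.neutral) auto
        then show False using l2 by simp
      qed
      fix p :: real assume p: "p \<ge> 2"
      \<comment> \<open>\<open>Q\<close> is the l^2 norm of the coefficients. The aligned sum is at
        least Q^2 / 2: one factor Q remains as the l^2 norm, the other is bounded below by a
        multiple of N^(\<mu>/2).\<close>
      define Q where "Q = sqrt (real M + 1)"
      have QQ: "Q * Q = real M + 1" by (simp add: Q_def)
      have Q: "sqrt \<epsilon> * real N powr (\<mu> / 2) / 3 \<le> Q"
      proof -
        \<comment> \<open>N is at most 2h + 1, hence at most 3h because h is at least 1.\<close>
        have "real N powr (\<mu> / 2) \<le> (3 * real h) powr (\<mu> / 2)"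
          using \<beta>\<mu> NN h by (intro powr_mono2) auto
        also have "\<dots> = 3 powr (\<mu> / 2) * real h powr (\<mu> / 2)" by (simp add: powr_mult)
        also have "\<dots> \<le> 3 powr 1 * real h powr (\<mu> / 2)"
          using \<beta>\<mu> by (intro mult_right_mono powr_mono) auto
        finally have "real N powr (\<mu> / 2) / 3 \<le> real h powr (\<mu> / 2)" by simp
        also have "\<dots> = sqrt (real h powr \<mu>)" by (simp add: powr_half_sqrt_powr)
        finally have "sqrt \<epsilon> * (real N powr (\<mu> / 2) / 3) \<le> sqrt \<epsilon> * sqrt (real h powr \<mu>)"
          using \<epsilon> by (intro mult_left_mono) auto
        also have "\<dots> \<le> Q" using M by (simp add: Q_def flip: real_sqrt_mult)
        finally show ?thesis by simp
      qed
      \<comment> \<open>The exponent is negative, so passing from N down to h only increases the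
        power.\<close>
      have hp: "real N powr - (\<beta> / p) \<le> real h powr - (\<beta> / p)"
        using \<beta>\<mu> p NN h by (intro powr_mono2') auto
      have "c * real N powr (\<mu> / 2 - \<beta> / p) * Q
          \<le> sqrt \<epsilon> / 6 * real N powr (\<mu> / 2 - \<beta> / p) * Q"
        using c by (intro mult_right_mono) (auto simp: Q_def)
      also have "\<dots> = real N powr - (\<beta> / p) * ((sqrt \<epsilon> * real N powr (\<mu> / 2) / 3) * Q / 2)"
        by (simp add: diff_conv_add_uminus powr_add del: add_uminus_conv_diff)
      also have "\<dots> \<le> real h powr - (\<beta> / p) * (Q * Q / 2)"
        using hp Q \<epsilon> by (intro mult_mono divide_right_mono) (auto simp: Q_def)
      also have "\<dots> = (x1 + real h powr - \<beta> - x1) powr (1 / p) * ((real M + 1) / 2)"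
        by (simp add: QQ powr_powr)
      also have "\<dots> \<le> Lp_norm p {-1<..<1} (?S N a)"
      proof (rule exponential_sum_Lp_norm_lower_bound[OF _ cont])
        show "{x1..x1 + real h powr - \<beta>} \<subseteq> {-1<..<1}" using x1 r assms(3) by auto
      qed (use p lower in auto)
      finally show "c * real N powr (\<mu> / 2 - \<beta> / p) * sqrt (\<Sum>n = - int N..int N. (norm (a n))\<^sup>2)
          \<le> Lp_norm p {-1<..<1} (?S N a)" by (simp only: l2 Q_def)
    qed
  qed
  show ?thesis
  proof (intro exI[of _ c] conjI allI impI)
    fix N :: nat assume "N \<ge> 1"
    from main[OF this] show "\<exists>a :: int \<Rightarrow> complex. (\<exists>n\<in>{- int N..int N}. a n \<noteq> 0) \<and>
        (\<forall>p::real. p \<ge> 2 \<longrightarrow> Lp_norm p {-1<..<1} (?S N a)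
          \<ge> c * real N powr ((2 * real k - 1) / (6 * (real k - 1)) - (real k + 1) / (3 * p * (real k - 1)))
            * sqrt (\<Sum>n = - int N..int N. (norm (a n))\<^sup>2))"
      by (simp only: exponent cong: imp_cong)
  qed (fact c(1))
qed

end
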